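(* Let $(G,w)$ be a weighted graph with $E(G)\neq\varnothing$. The weight $w$ is pseudoultrametrizable if and only if, for each cycle $C\subseteq G$, there exist at least two distinct edges $e_1,e_2\in E(C)$ such that $$w(e_1)=w(e_2)=\max_{e\in E(C)}w(e).$$ Moreover, if $G$ is a connected graph and $w$ is a pseudoultrametrizable weight, then the subdominant pseudoultrametric $\rho_w$ for $w$ extends $w$.
   Context: A graph $G=(V(G),E(G))$ has a nonempty (possibly infinite) vertex set $V(G)$, and its edge set $E(G)$ (possibly empty) is a set of unordered pairs of distinct vertices. A path is a finite graph with at least one edge whose vertices can be enumerated without repetition as $v_1,\dots,v_n$ so that $\{v_i,v_j\}$ is an edge iff $|i-j|=1$; it connects $v_1$ and $v_n$. A cycle is a finite graph with at least $3$ vertices that can be enumerated without repetition as $v_1,\dots,v_n$ so that $\{v_i,v_j\}$ is an edge iff $|i-j|=1$ or $|i-j|=n-1$. $C\subseteq G$ means $C$ is a (not necessarily induced) subgraph of $G$. $G$ is connected if any two distinct vertices are connected by a path in $G$. A weighted graph $(G,w)$ is a graph $G$ with a function (weight) $w:E(G)\to\mathbb{R}^+=[0,+\infty)$. A pseudoultrametric on a set $X$ is a function $d:X\times X\to\mathbb{R}^+$ with $d(x,y)=d(y,x)$, $d(x,x)=0$ and $d(x,y)\le\max\{d(x,z),d(z,y)\}$ for all $x,y,z\in X$. A pseudoultrametric $d$ on $V(G)$ extends $w$ if $d(x,y)=w(\{x,y\})$ for every $\{x,y\}\in E(G)$. The weight $w$ is pseudoultrametrizable if some pseudoultrametric on $V(G)$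 extends $w$. Let $\mathfrak{F}_{w,u}$ be the set of pseudoultrametrics $\rho$ on $V(G)$ with $\rho(u,v)\le w(\{u,v\})$ for every $\{u,v\}\in E(G)$, ordered pointwise: $\rho_1\preceq\rho_2$ iff $\rho_1(x,y)\le\rho_2(x,y)$ for all $x,y\in V(G)$. The subdominant pseudoultrametric for $w$ is the greatest element of $(\mathfrak{F}_{w,u},\preceq)$, if it exists. For connected $G$ it exists and is given by $\rho_w(x,x)=0$ and, for $x\ne y$, $\rho_w(x,y)=\inf_{P\in\mathfrak{P}_{x,y}}\max_{e\in E(P)}w(e)$, where $\mathfrak{P}_{x,y}$ is the set of paths in $G$ connecting $x$ and $y$. *)

theory Defs
  imports Complex_Main
begin

record 'a sgraph =
  verts :: "'a set"
  edges :: "'a set set"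

definition is_graph :: "'a sgraph \<Rightarrow> bool" where
  "is_graph G \<longleftrightarrow> verts G \<noteq> {} \<and>
     (\<forall>e \<in> edges G. \<exists>u \<in> verts G. \<exists>v \<in> verts G. u \<noteq> v \<and> e = {u, v})"

definition subgraph :: "'a sgraph \<Rightarrow> 'a sgraph \<Rightarrow> bool" where
  "subgraph H G \<longleftrightarrow> is_graph H \<and> is_graph G \<and> verts H \<subseteq> verts G \<and> edges H \<subseteq> edges G"

definition path_connecting :: "'a sgraph \<Rightarrow> 'a \<Rightarrow> 'a \<Rightarrow> bool" where
  "path_connecting P x y \<longleftrightarrow> is_graph P \<and> edges P \<noteq> {} \<and>
     (\<exists>vs. distinct vs \<and> set vs = verts P \<and> hd vs = x \<and> last vs = y \<and>
       (\<forall>i < length vs. \<forall>j < length vs.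
          {vs ! i, vs ! j} \<in> edges P \<longleftrightarrow> \<bar>int i - int j\<bar> = 1))"

definition is_cycle :: "'a sgraph \<Rightarrow> bool" where
  "is_cycle C \<longleftrightarrow> is_graph C \<and>
     (\<exists>vs. distinct vs \<and> set vs = verts C \<and> length vs \<ge> 3 \<and>
       (\<forall>i < length vs. \<forall>j < length vs.
          {vs ! i, vs ! j} \<in> edges C \<longleftrightarrow>
            \<bar>int i - int j\<bar> = 1 \<or> \<bar>int i - int j\<bar> = int (length vs) - 1))"

definition connected_graph :: "'a sgraph \<Rightarrow> bool" where
  "connected_graph G \<longleftrightarrow> is_graph G \<and>
     (\<forall>x \<in> verts G. \<forall>y \<in> verts G. x \<noteq> y \<longrightarrow> (\<exists>P. subgraph P G \<and> path_connecting P x y))"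

text \<open>Only the values of a weight on edges, and those of a pseudoultrametric on
  the vertex set, are meaningful; other values are ignored throughout.\<close>

definition weighted_graph :: "'a sgraph \<Rightarrow> ('a set \<Rightarrow> real) \<Rightarrow> bool" where
  "weighted_graph G w \<longleftrightarrow> is_graph G \<and> (\<forall>e \<in> edges G. 0 \<le> w e)"

definition pseudoultrametric_on :: "'a set \<Rightarrow> ('a \<Rightarrow> 'a \<Rightarrow> real) \<Rightarrow> bool" where
  "pseudoultrametric_on X d \<longleftrightarrow>
     (\<forall>x \<in> X. \<forall>y \<in> X. 0 \<le> d x y) \<and>
     (\<forall>x \<in> X. \<forall>y \<in> X. d x y = d y x) \<and>
     (\<forall>x \<in> X. d x x = 0) \<and>
     (\<forall>x \<in> X. \<forall>y \<in> X. \<forall>z \<in> X. d x y \<le> max (d x z) (d z y))"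

definition extends_weight :: "'a sgraph \<Rightarrow> ('a set \<Rightarrow> real) \<Rightarrow> ('a \<Rightarrow> 'a \<Rightarrow> real) \<Rightarrow> bool" where
  "extends_weight G w d \<longleftrightarrow> (\<forall>u v. {u, v} \<in> edges G \<longrightarrow> d u v = w {u, v})"

definition pseudoultrametrizable :: "'a sgraph \<Rightarrow> ('a set \<Rightarrow> real) \<Rightarrow> bool" where
  "pseudoultrametrizable G w \<longleftrightarrow>
     (\<exists>d. pseudoultrametric_on (verts G) d \<and> extends_weight G w d)"

definition dominated_pseudoultrametrics ::
    "'a sgraph \<Rightarrow> ('a set \<Rightarrow> real) \<Rightarrow> ('a \<Rightarrow> 'a \<Rightarrow> real) set" where
  "dominated_pseudoultrametrics G w =
     {\<rho>. pseudoultrametric_on (verts G) \<rho> \<and> (\<forall>u v. {u, v} \<in> edges G \<longrightarrow> \<rho> u v \<le> w {u, v})}"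

text \<open>The greatest element for the pointwise order on the vertex set; as a HOL function it is
  unique only up to its irrelevant values outside the vertex set, hence a predicate.\<close>

definition is_subdominant :: "'a sgraph \<Rightarrow> ('a set \<Rightarrow> real) \<Rightarrow> ('a \<Rightarrow> 'a \<Rightarrow> real) \<Rightarrow> bool" where
  "is_subdominant G w \<rho> \<longleftrightarrow> \<rho> \<in> dominated_pseudoultrametrics G w \<and>
     (\<forall>\<sigma> \<in> dominated_pseudoultrametrics G w. \<forall>x \<in> verts G. \<forall>y \<in> verts G. \<sigma> x y \<le> \<rho> x y)"

end

theory Submission
  imports Defs
begin

text \<open>
  Necessity is the isosceles principle around a cycle: if one edge of a cycle were strictly heavier
  than all the others, then the strong triangle inequality along the remaining edges would make its
  two ends strictly closer to each other than its own weight (\<open>heaviest_edge_not_unique\<close>).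

  For sufficiency, let the bottleneck distance of \<open>x\<close> and \<open>y\<close> be the infimum of those \<open>t\<close> for which
  \<open>y\<close> can be reached from \<open>x\<close> along edges of weight at most \<open>t\<close>. Concatenating two walks does not
  raise the heaviest weight met, hence the strong triangle inequality within a component. The
  bottleneck distance never exceeds the weight on an edge. If it were smaller than the weight of an edge \<open>{u, v}\<close>, then a repetition-free walk
  from \<open>u\<close> to \<open>v\<close> along lighter edges, closed by \<open>{u, v}\<close>, would be a cycle with a unique heaviest
  edge (\<open>light_walk_closes_to_cycle\<close>). Between components no walk exists and the infimum means
  nothing, so there the distance is routed through one base point per component, all base points
  being put at distance zero from each other (\<open>glue_components\<close>). A constant distance between
  components would not do, since components may be unbounded.

  For connected graphs the bottleneck distance is the subdominant pseudoultrametric: the strong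
  triangle inequality along a walk bounds every dominated one by it (\<open>bottleneck_is_subdominant\<close>). That a
  subdominant \<open>\<rho>\<close> extends \<open>w\<close> follows from maximality alone: a pseudoultrametric extending \<open>w\<close> is
  dominated, so \<open>\<rho>\<close> lies above it everywhere, while it lies below \<open>w\<close> on edges.
\<close>

section \<open>Walks along light edges\<close>

definition light_adj :: "'a sgraph \<Rightarrow> ('a set \<Rightarrow> real) \<Rightarrow> real \<Rightarrow> ('a \<times> 'a) set" where
  "light_adj G w t = {(u, v). {u, v} \<in> edges G \<and> w {u, v} \<le> t}"

text \<open>A nonempty set of levels says that the two vertices lie in the same component. The empty
  walk exists at every real level, so \<open>0 \<le> t\<close> is what makes the infimum \<open>0\<close> from a vertex to
  itself.\<close>

definition levels :: "'a sgraph \<Rightarrow> ('a set \<Rightarrow> real) \<Rightarrow> 'a \<Rightarrow> 'a \<Rightarrow> real set" where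
  "levels G w x y = {t. 0 \<le> t \<and> (x, y) \<in> (light_adj G w t)\<^sup>*}"

definition bottleneck :: "'a sgraph \<Rightarrow> ('a set \<Rightarrow> real) \<Rightarrow> 'a \<Rightarrow> 'a \<Rightarrow> real" where
  "bottleneck G w x y = Inf (levels G w x y)"

lemma edge_ends:
  assumes "is_graph G" "{u, v} \<in> edges G"
  shows "u \<in> verts G" "v \<in> verts G" "u \<noteq> v"
  using assms unfolding is_graph_def by (fastforce simp: doubleton_eq_iff)+

lemma light_adj_mono: "s \<le> t \<Longrightarrow> light_adj G w s \<subseteq> light_adj G w t"
  unfolding light_adj_def by auto

lemma levels_upward: "s \<in> levels G w x y \<Longrightarrow> s \<le> t \<Longrightarrow> t \<in> levels G w x y"
  unfolding levels_def using rtrancl_mono[OF light_adj_mono, of s t G w] by auto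

lemma levels_sym: "levels G w x y = levels G w y x"
proof -
  have "sym ((light_adj G w t)\<^sup>*)" for t
    by (intro sym_rtrancl symI) (auto simp: light_adj_def insert_commute)
  then show ?thesis
    unfolding levels_def by (auto dest: symD)
qed

lemma levels_trans: "t \<in> levels G w x z \<Longrightarrow> t \<in> levels G w z y \<Longrightarrow> t \<in> levels G w x y"
  unfolding levels_def by auto

lemma zero_in_levels_refl: "0 \<in> levels G w x x"
  unfolding levels_def by auto

lemma weight_in_levels:
  assumes "weighted_graph G w" "{u, v} \<in> edges G"
  shows "w {u, v} \<in> levels G w u v"
  using assms unfolding weighted_graph_def levels_def light_adj_def by auto

lemma same_component_trans:
  assumes "levels G w x z \<noteq> {}" "levels G w z y \<noteq> {}"
  shows "levels G w x y \<noteq> {}"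
proof -
  obtain s t where "s \<in> levels G w x z" "t \<in> levels G w z y"
    using assms by blast
  then have "max s t \<in> levels G w x y"
    by (meson levels_trans levels_upward max.cobounded1 max.cobounded2)
  then show ?thesis by blast
qed

lemma equivp_same_component: "equivp (\<lambda>x y. levels G w x y \<noteq> {})"
proof (rule equivpI)
  show "reflp (\<lambda>x y. levels G w x y \<noteq> {})"
    by (rule reflpI) (metis zero_in_levels_refl empty_iff)
  show "symp (\<lambda>x y. levels G w x y \<noteq> {})"
    by (rule sympI) (subst levels_sym, assumption)
  show "transp (\<lambda>x y. levels G w x y \<noteq> {})"
    by (rule transpI) (rule same_component_trans, assumption+)
qed

lemma ex_repetition_free_walk:
  assumes "(x, y) \<in> R\<^sup>*"
  shows "\<exists>vs. vs \<noteq> [] \<and> hd vs = x \<and> last vs = y \<and> distinct vs \<and> successively (\<lambda>a b. (a, b) \<in> R) vs"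
  using assms
proof (induction rule: rtrancl_induct)
  case base
  show ?case by (rule exI[of _ "[x]"]) simp
next
  case (step y z)
  then obtain vs where vs: "vs \<noteq> []" "hd vs = x" "last vs = y" "distinct vs"
    "successively (\<lambda>a b. (a, b) \<in> R) vs" by blast
  show ?case
  proof (cases "z \<in> set vs")
    case True
    \<comment> \<open>The walk has already visited \<open>z\<close>: cut it there.\<close>
    then obtain as bs where "vs = as @ z # bs" by (meson split_list)
    then show ?thesis
      using vs by (intro exI[of _ "as @ [z]"]) (auto simp: successively_append_iff hd_append)
  next
    case False
    then show ?thesis
      using vs step.hyps by (intro exI[of _ "vs @ [z]"]) (auto simp: successively_append_iff)
  qed
qed

lemma bounded_along_light_walk:
  assumes G: "is_graph G" and d: "pseudoultrametric_on (verts G) d"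
    and dom: "\<And>u v. {u, v} \<in> edges G \<Longrightarrow> d u v \<le> w {u, v}"
    and x: "x \<in> verts G" and t: "t \<in> levels G w x y"
  shows "d x y \<le> t"
proof -
  have "0 \<le> t" and walk: "(x, y) \<in> (light_adj G w t)\<^sup>*"
    using t unfolding levels_def by auto
  from walk have "y \<in> verts G \<and> d x y \<le> t"
  proof (induction rule: rtrancl_induct)
    case base
    show ?case using d x \<open>0 \<le> t\<close> unfolding pseudoultrametric_on_def by auto
  next
    case (step y z)
    then have e: "{y, z} \<in> edges G" "w {y, z} \<le> t" unfolding light_adj_def by auto
    have z: "z \<in> verts G" using edge_ends[OF G e(1)] by simp
    have "d x z \<le> max (d x y) (d y z)"
      using d x step.IH z unfolding pseudoultrametric_on_def by blast
    also have "\<dots> \<le> t" using step.IH dom[OF e(1)] e(2) by simp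
    finally show ?case using z by simp
  qed
  then show ?thesis by simp
qed

section \<open>The bottleneck distance\<close>

lemma bdd_below_levels: "bdd_below (levels G w x y)"
  by (rule bdd_belowI[of _ 0]) (simp add: levels_def)

lemma bottleneck_le: "t \<in> levels G w x y \<Longrightarrow> bottleneck G w x y \<le> t"
  unfolding bottleneck_def by (rule cInf_lower[OF _ bdd_below_levels])

lemma bottleneck_less_imp_level:
  assumes "levels G w x y \<noteq> {}" "bottleneck G w x y < t"
  shows "\<exists>s<t. s \<in> levels G w x y"
  using assms cInf_lessD unfolding bottleneck_def by blast

lemma bottleneck_nonneg: "levels G w x y \<noteq> {} \<Longrightarrow> 0 \<le> bottleneck G w x y"
  unfolding bottleneck_def by (rule cInf_greatest) (auto simp: levels_def)

lemma bottleneck_sym: "bottleneck G w x y = bottleneck G w y x"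
  unfolding bottleneck_def by (subst levels_sym) (rule refl)

lemma bottleneck_refl: "bottleneck G w x x = 0"
  using bottleneck_le[OF zero_in_levels_refl] bottleneck_nonneg zero_in_levels_refl
  by (metis antisym empty_iff)

lemma bottleneck_ultra:
  assumes "levels G w x z \<noteq> {}" "levels G w z y \<noteq> {}"
  shows "bottleneck G w x y \<le> max (bottleneck G w x z) (bottleneck G w z y)"
proof (rule dense_ge)
  fix t assume "max (bottleneck G w x z) (bottleneck G w z y) < t"
  then have "t \<in> levels G w x z" "t \<in> levels G w z y"
    using bottleneck_less_imp_level[OF assms(1)] bottleneck_less_imp_level[OF assms(2)]
    by (meson levels_upward less_imp_le max_less_iff_conj)+
  then show "bottleneck G w x y \<le> t"
    by (meson bottleneck_le levels_trans)
qed

text \<open>Base points are made to coincide, so a distance between two components is the larger of the two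
  distances to the base points; this keeps the strong triangle inequality, however large the
  components are.\<close>

lemma glue_components:
  fixes d :: "'a \<Rightarrow> 'a \<Rightarrow> real"
  assumes eqv: "equivp R"
    and nonneg: "\<And>x y. R x y \<Longrightarrow> 0 \<le> d x y"
    and sym: "\<And>x y. d x y = d y x"
    and refl: "\<And>x. d x x = 0"
    and ultra: "\<And>x y z. R x z \<Longrightarrow> R z y \<Longrightarrow> d x y \<le> max (d x z) (d z y)"
  shows "\<exists>d'. pseudoultrametric_on X d' \<and> (\<forall>x y. R x y \<longrightarrow> d' x y = d x y)"
proof -
  define r where "r x = (SOME z. R x z)" for x
  define d' where "d' x y = (if R x y then d x y else max (d x (r x)) (d y (r y)))" for x y
  have R_refl: "R x x" and R_sym: "R x y \<Longrightarrow> R y x" and R_trans: "R x y \<Longrightarrow> R y z \<Longrightarrow> R x z" for x y z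
    using eqv by (auto elim: equivpE dest: reflpD sympD transpD)
  have base: "R x (r x)" for x
    unfolding r_def by (rule someI[of _ x]) (rule R_refl)
  have same_base: "r x = r y" if "R x y" for x y
  proof -
    have "R x = R y" using that R_sym R_trans by blast
    then show ?thesis unfolding r_def by simp
  qed
  have "d' x y \<le> max (d' x z) (d' z y)" for x y z
  proof -
    consider "R x z" "R z y" | "R x z" "\<not> R z y" | "\<not> R x z" "R z y"
      | "\<not> R x z" "\<not> R z y" "R x y" | "\<not> R x z" "\<not> R z y" "\<not> R x y" by blast
    then show ?thesis
    proof cases
      case 1
      then show ?thesis using ultra R_trans unfolding d'_def by simp
    next
      case 2
      then have "\<not> R x y" using R_sym R_trans by blast
      moreover have "d x (r x) \<le> max (d x z) (d z (r z))"
        using ultra[OF 2(1) base] same_base[OF 2(1)] by simp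
      ultimately show ?thesis using 2 unfolding d'_def by auto
    next
      case 3
      then have "\<not> R x y" using R_sym R_trans by blast
      moreover have "d y (r y) \<le> max (d z y) (d z (r z))"
        using ultra[OF R_sym[OF 3(2)] base] same_base[OF 3(2)] sym[of y z] by simp
      ultimately show ?thesis using 3 unfolding d'_def by auto
    next
      case 4
      have "d x y \<le> max (d x (r x)) (d y (r y))"
        using ultra[OF base[of x]] R_sym[OF base[of y]] same_base[OF 4(3)] sym[of y "r y"] by metis
      then show ?thesis using 4 unfolding d'_def by auto
    next
      case 5
      then show ?thesis unfolding d'_def by auto
    qed
  qed
  moreover have "0 \<le> d' x y" for x y
    using nonneg base unfolding d'_def by (auto simp: le_max_iff_disj)
  moreover have "d' x y = d' y x" for x y
    using sym R_sym unfolding d'_def by (auto simp: max.commute)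
  moreover have "d' x x = 0" for x
    using refl R_refl unfolding d'_def by simp
  ultimately have "pseudoultrametric_on X d'"
    unfolding pseudoultrametric_on_def by blast
  then show ?thesis unfolding d'_def by auto
qed

lemma ex_pseudoultrametric_eq_bottleneck:
  "\<exists>d. pseudoultrametric_on X d \<and> (\<forall>x y t. t \<in> levels G w x y \<longrightarrow> d x y = bottleneck G w x y)"
proof -
  have "\<exists>d. pseudoultrametric_on X d \<and> (\<forall>x y. levels G w x y \<noteq> {} \<longrightarrow> d x y = bottleneck G w x y)"
    by (rule glue_components[where R = "\<lambda>x y. levels G w x y \<noteq> {}" and d = "bottleneck G w",
          OF equivp_same_component bottleneck_nonneg bottleneck_sym bottleneck_refl bottleneck_ultra])
  then show ?thesis by (metis empty_iff)
qed

section \<open>Cycles and the weight of their edges\<close>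

text \<open>A walk from \<open>u\<close> to \<open>v\<close> lighter than the edge \<open>{u, v}\<close> avoids that edge, so its
  repetition-free version has a third vertex and is closed by \<open>{u, v}\<close> to a cycle.\<close>

lemma light_walk_closes_to_cycle:
  assumes G: "is_graph G" and uv: "{u, v} \<in> edges G"
    and t: "t \<in> levels G w u v" "t < w {u, v}"
  shows "\<exists>C. is_cycle C \<and> subgraph C G \<and> {u, v} \<in> edges C \<and>
           (\<forall>e \<in> edges C. e \<noteq> {u, v} \<longrightarrow> w e \<le> t)"
proof -
  have "(u, v) \<in> (light_adj G w t)\<^sup>*" using t unfolding levels_def by simp
  from ex_repetition_free_walk[OF this] obtain vs where
    vs: "vs \<noteq> []" "hd vs = u" "last vs = v" "distinct vs"
      "successively (\<lambda>a b. (a, b) \<in> light_adj G w t) vs" by blast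
  let ?n = "length vs"
  have adj: "{vs ! i, vs ! Suc i} \<in> edges G" "w {vs ! i, vs ! Suc i} \<le> t" if "Suc i < ?n" for i
    using vs(5) that unfolding successively_conv_nth light_adj_def by auto
  have first: "vs ! 0 = u" and final: "vs ! (?n - 1) = v"
    using vs(1,2,3) by (simp_all add: hd_conv_nth last_conv_nth)
  have "u \<noteq> v" using edge_ends[OF G uv] by simp
  have n: "?n \<ge> 3"
  proof (rule ccontr)
    assume "\<not> ?n \<ge> 3"
    moreover have "?n \<noteq> 0" using vs(1) by simp
    ultimately have "?n = 1 \<or> ?n = 2" by linarith
    then show False using first final \<open>u \<noteq> v\<close> adj(2)[of 0] t(2) by auto
  qed
  define C :: "'a sgraph" where
    "C = \<lparr>verts = set vs, edges = insert {u, v} {{vs ! i, vs ! Suc i} |i. Suc i < ?n}\<rparr>"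
  have edge_iff: "{vs ! i, vs ! j} \<in> edges C \<longleftrightarrow>
      \<bar>int i - int j\<bar> = 1 \<or> \<bar>int i - int j\<bar> = int ?n - 1" if ij: "i < ?n" "j < ?n" for i j
  proof -
    have "{vs ! i, vs ! j} = {u, v} \<longleftrightarrow> i = 0 \<and> j = ?n - 1 \<or> i = ?n - 1 \<and> j = 0"
      unfolding first[symmetric] final[symmetric] doubleton_eq_iff
      using ij n vs(4) by (subst (1 2 3 4) nth_eq_iff_index_eq) auto
    moreover have "{vs ! i, vs ! j} = {vs ! k, vs ! Suc k} \<longleftrightarrow> i = k \<and> j = Suc k \<or> i = Suc k \<and> j = k"
      if "Suc k < ?n" for k
      unfolding doubleton_eq_iff
      using ij that vs(4) by (subst (1 2 3 4) nth_eq_iff_index_eq) auto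
    ultimately have "{vs ! i, vs ! j} \<in> edges C \<longleftrightarrow>
        (i = 0 \<and> j = ?n - 1 \<or> i = ?n - 1 \<and> j = 0) \<or> j = Suc i \<or> i = Suc j"
      unfolding C_def using ij by auto
    then show ?thesis using ij n by auto
  qed
  have "vs ! i \<in> verts G" if "i < ?n" for i
  proof (cases "Suc i < ?n")
    case True
    then show ?thesis using adj(1) edge_ends[OF G] by blast
  next
    case False
    then have "i = ?n - 1" using that by simp
    then show ?thesis using final edge_ends[OF G uv] by simp
  qed
  then have verts: "verts C \<subseteq> verts G"
    unfolding C_def by (auto simp: in_set_conv_nth)
  have edges: "edges C \<subseteq> edges G"
    unfolding C_def using adj(1) uv by auto
  have "is_graph C"
    unfolding is_graph_def
  proof (intro conjI ballI)
    show "verts C \<noteq> {}" using vs(1) unfolding C_def by simp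
    fix e assume e: "e \<in> edges C"
    then obtain a b where ab: "e = {a, b}" "a \<in> verts C" "b \<in> verts C"
      using vs(1-3) hd_in_set last_in_set unfolding C_def by fastforce
    moreover have "a \<noteq> b" using ab(1) e edges edge_ends[OF G] by blast
    ultimately show "\<exists>u\<in>verts C. \<exists>v\<in>verts C. u \<noteq> v \<and> e = {u, v}" by blast
  qed
  then have "is_cycle C"
    unfolding is_cycle_def using vs(4) n edge_iff by (auto simp: C_def intro!: exI[of _ vs])
  moreover have "subgraph C G"
    unfolding subgraph_def using \<open>is_graph C\<close> G verts edges by simp
  moreover have "\<forall>e \<in> edges C. e \<noteq> {u, v} \<longrightarrow> w e \<le> t"
    using adj(2) unfolding C_def by auto
  ultimately show ?thesis
    by (intro exI[of _ C]) (simp add: C_def)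
qed

text \<open>The periodic enumeration makes all edges of a cycle look alike, so that the walk around the
  cycle can be started behind any chosen edge.\<close>

lemma cycle_periodic_enumeration:
  fixes C :: "'a sgraph"
  assumes "is_cycle C"
  obtains n and f :: "nat \<Rightarrow> 'a" where
    "n \<ge> 3" "\<And>k. f (k + n) = f k"
    "\<And>k. {f k, f (Suc k)} \<in> edges C" "\<And>e. e \<in> edges C \<Longrightarrow> \<exists>k<n. e = {f k, f (Suc k)}"
    "\<And>i j. {f i, f (Suc i)} = {f j, f (Suc j)} \<Longrightarrow> i mod n = j mod n"
proof -
  obtain vs where C: "is_graph C" and vs: "distinct vs" "set vs = verts C" "length vs \<ge> 3"
    and adj: "\<And>i j. i < length vs \<Longrightarrow> j < length vs \<Longrightarrow> {vs ! i, vs ! j} \<in> edges C \<longleftrightarrow>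
          \<bar>int i - int j\<bar> = 1 \<or> \<bar>int i - int j\<bar> = int (length vs) - 1"
    using assms unfolding is_cycle_def by blast
  define n where "n = length vs"
  define f where "f k = vs ! (k mod n)" for k
  have n: "n \<ge> 3" using vs(3) n_def by simp
  have f_eq: "f i = f j \<longleftrightarrow> i mod n = j mod n" for i j
    unfolding f_def using vs(1) n mod_less_divisor[of n] by (subst nth_eq_iff_index_eq) (auto simp flip: n_def)
  have wrap: "Suc (n - 1) mod n = 0" using n by simp
  have fwd: "{f k, f (Suc k)} \<in> edges C" for k
  proof -
    define i where "i = k mod n"
    have "i < n" using n unfolding i_def by simp
    then have "{vs ! i, vs ! (Suc i mod n)} \<in> edges C"
      using adj[of i "Suc i mod n"] n unfolding n_def[symmetric] by (cases "Suc i = n") auto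
    then show ?thesis unfolding f_def i_def by (simp add: mod_Suc_eq)
  qed
  have bwd: "\<exists>k<n. e = {f k, f (Suc k)}" if "e \<in> edges C" for e
  proof -
    obtain a b where "e = {a, b}" "a \<in> set vs" "b \<in> set vs"
      using C \<open>e \<in> edges C\<close> unfolding is_graph_def vs(2) by meson
    then obtain i j where ij: "i < n" "j < n" "e = {vs ! i, vs ! j}"
      unfolding in_set_conv_nth n_def by blast
    then have "\<bar>int i - int j\<bar> = 1 \<or> \<bar>int i - int j\<bar> = int n - 1"
      using adj[of i j] that unfolding n_def by simp
    then consider "j = Suc i" | "i = Suc j" | "i = 0" "j = n - 1" | "j = 0" "i = n - 1"
      using ij(1,2) by linarith
    then show ?thesis
    proof cases
      case 1
      then show ?thesis using ij by (intro exI[of _ i]) (simp add: f_def)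
    next
      case 2
      then show ?thesis using ij by (intro exI[of _ j]) (auto simp: f_def)
    next
      case 3
      then show ?thesis using ij n by (intro exI[of _ "n - 1"]) (auto simp: f_def wrap)
    next
      case 4
      then show ?thesis using ij n by (intro exI[of _ "n - 1"]) (auto simp: f_def wrap)
    qed
  qed
  have "i mod n = j mod n" if "{f i, f (Suc i)} = {f j, f (Suc j)}" for i j
  proof (rule ccontr)
    assume "i mod n \<noteq> j mod n"
    then have "i mod n = Suc j mod n" "Suc i mod n = j mod n"
      using that by (auto simp: doubleton_eq_iff f_eq)
    then have "Suc (Suc j) mod n = j mod n"
      by (metis mod_Suc_eq)
    \<comment> \<open>A third vertex rules out two distinct edges with the same ends.\<close>
    then have "n dvd 2"
      using mod_eq_dvd_iff_nat[of j "Suc (Suc j)" n] by simp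
    then show False using n by (auto dest: dvd_imp_le)
  qed
  moreover have "f (k + n) = f k" for k unfolding f_def by simp
  ultimately show ?thesis using that n fwd bwd by blast
qed

lemma finite_cycle_edges:
  assumes "is_cycle C"
  shows "finite (edges C)"
proof -
  have "finite (verts C)"
    using assms unfolding is_cycle_def by (metis List.finite_set)
  moreover have "edges C \<subseteq> Pow (verts C)"
    using assms edge_ends unfolding is_cycle_def is_graph_def by fastforce
  ultimately show ?thesis by (metis finite_Pow_iff finite_subset)
qed

lemma heaviest_edge_not_unique:
  fixes C :: "'a sgraph"
  assumes d: "pseudoultrametric_on (verts G) d" and ext: "extends_weight G w d"
    and C: "is_cycle C" "subgraph C G"
  shows "\<exists>e\<^sub>1 \<in> edges C. \<exists>e\<^sub>2 \<in> edges C. e\<^sub>1 \<noteq> e\<^sub>2 \<and> w e\<^sub>1 = w e\<^sub>2 \<and> w e\<^sub>2 = Max (w ` edges C)"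
proof (rule cycle_periodic_enumeration[OF C(1)], rule ccontr)
  fix n and f :: "nat \<Rightarrow> 'a"
  assume n: "n \<ge> 3" and per: "\<And>k. f (k + n) = f k"
    and edge: "\<And>k. {f k, f (Suc k)} \<in> edges C"
    and enum: "\<And>e. e \<in> edges C \<Longrightarrow> \<exists>k<n. e = {f k, f (Suc k)}"
    and inj: "\<And>i j. {f i, f (Suc i)} = {f j, f (Suc j)} \<Longrightarrow> i mod n = j mod n"
    and unique: "\<not> ?thesis"
  define M where "M = Max (w ` edges C)"
  note fin = finite_cycle_edges[OF C(1)]
  have "M \<in> w ` edges C" unfolding M_def using fin edge by (intro Max_in) auto
  then obtain i where i: "w {f i, f (Suc i)} = M" using enum by auto
  have sub: "is_graph G" "edges C \<subseteq> edges G" using C(2) unfolding subgraph_def by auto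
  have ends: "f k \<in> verts G" for k
    using edge_ends(1)[OF sub(1)] edge sub(2) by blast
  have d_edge: "d (f k) (f (Suc k)) = w {f k, f (Suc k)}" for k
    using ext edge[of k] sub(2) unfolding extends_weight_def by blast
  have lighter: "d (f (Suc i + m)) (f (Suc (Suc i + m))) < M" if "m < n - 1" for m
  proof -
    let ?e = "{f (Suc i + m), f (Suc (Suc i + m))}"
    have "?e \<noteq> {f i, f (Suc i)}"
    proof
      assume "?e = {f i, f (Suc i)}"
      from inj[OF this] have "n dvd Suc m"
        using mod_eq_dvd_iff_nat[of i "Suc i + m" n] by simp
      then show False using that by (auto dest: dvd_imp_le)
    qed
    then have "w ?e \<noteq> M" using unique edge i M_def by metis
    moreover have "w ?e \<le> M" unfolding M_def using fin edge by simp
    ultimately show ?thesis using d_edge by simp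
  qed
  have "0 \<le> d (f (Suc i)) (f (Suc (Suc i)))"
    using d ends unfolding pseudoultrametric_on_def by blast
  also have "\<dots> < M" using lighter[of 0] n by simp
  finally have "0 < M" .
  have around: "d (f (Suc i)) (f (Suc i + m)) < M" if "m \<le> n - 1" for m
    using that
  proof (induction m)
    case 0
    then show ?case using d ends \<open>0 < M\<close> unfolding pseudoultrametric_on_def by simp
  next
    case (Suc m)
    have "d (f (Suc i)) (f (Suc i + Suc m)) \<le>
        max (d (f (Suc i)) (f (Suc i + m))) (d (f (Suc i + m)) (f (Suc i + Suc m)))"
      using d ends unfolding pseudoultrametric_on_def by blast
    also have "\<dots> < M" using Suc lighter[of m] by simp
    finally show ?case .
  qed
  \<comment> \<open>After \<open>n - 1\<close> steps the walk arrives at the other end of the heaviest edge.\<close>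
  have "Suc i + (n - 1) = i + n" using n by simp
  then have "d (f (Suc i)) (f i) < M" using around[of "n - 1"] per by simp
  moreover have "d (f (Suc i)) (f i) = M"
    using d ends d_edge i unfolding pseudoultrametric_on_def by metis
  ultimately show False by simp
qed

text \<open>The bottleneck distance cannot undercut an edge, because the cycle so created would have a
  unique heaviest edge.\<close>

lemma pseudoultrametrizable_if_cycles:
  assumes G: "weighted_graph G w"
    and cycles: "\<And>C. is_cycle C \<Longrightarrow> subgraph C G \<Longrightarrow> \<exists>e\<^sub>1 \<in> edges C. \<exists>e\<^sub>2 \<in> edges C. e\<^sub>1 \<noteq> e\<^sub>2 \<and>
                 w e\<^sub>1 = w e\<^sub>2 \<and> w e\<^sub>2 = Max (w ` edges C)"
  shows "pseudoultrametrizable G w"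
proof -
  have graph: "is_graph G" using G unfolding weighted_graph_def by simp
  obtain d where d: "pseudoultrametric_on (verts G) d"
    and d_eq: "\<And>x y t. t \<in> levels G w x y \<Longrightarrow> d x y = bottleneck G w x y"
    using ex_pseudoultrametric_eq_bottleneck[of "verts G" G w] by blast
  have "d u v = w {u, v}" if uv: "{u, v} \<in> edges G" for u v
  proof -
    note level = weight_in_levels[OF G uv]
    have "\<not> bottleneck G w u v < w {u, v}"
    proof
      assume "bottleneck G w u v < w {u, v}"
      then obtain t where t: "t \<in> levels G w u v" "t < w {u, v}"
        using bottleneck_less_imp_level[of G w u v] level by (metis empty_iff)
      obtain C where C: "is_cycle C" "subgraph C G" "{u, v} \<in> edges C"
        and light: "\<And>e. e \<in> edges C \<Longrightarrow> e \<noteq> {u, v} \<Longrightarrow> w e \<le> t"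
        using light_walk_closes_to_cycle[OF graph uv t] by blast
      have "w {u, v} \<le> Max (w ` edges C)"
        using C(3) finite_cycle_edges[OF C(1)] by simp
      moreover obtain e\<^sub>1 e\<^sub>2 where "e\<^sub>1 \<in> edges C" "e\<^sub>2 \<in> edges C" "e\<^sub>1 \<noteq> e\<^sub>2"
        "w e\<^sub>1 = w e\<^sub>2" "w e\<^sub>2 = Max (w ` edges C)"
        using cycles[OF C(1,2)] by blast
      ultimately show False
        using light[of e\<^sub>1] light[of e\<^sub>2] t(2) by (cases "e\<^sub>1 = {u, v}") auto
    qed
    then show ?thesis using bottleneck_le[OF level] d_eq[OF level] by simp
  qed
  then show ?thesis using d unfolding pseudoultrametrizable_def extends_weight_def by blast
qed

section \<open>The subdominant pseudoultrametric\<close>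

lemma path_imp_levels_nonempty:
  assumes G: "weighted_graph G w" and P: "subgraph P G" "path_connecting P x y"
  shows "levels G w x y \<noteq> {}"
proof -
  obtain vs where vs: "set vs = verts P" "hd vs = x" "last vs = y"
    and adj: "\<And>i j. i < length vs \<Longrightarrow> j < length vs \<Longrightarrow>
                {vs ! i, vs ! j} \<in> edges P \<longleftrightarrow> \<bar>int i - int j\<bar> = 1"
    using P(2) unfolding path_connecting_def by blast
  have "verts P \<noteq> {}" using P(1) unfolding subgraph_def is_graph_def by simp
  then have ne: "vs \<noteq> []" using vs(1) by auto
  have "levels G w (vs ! 0) (vs ! i) \<noteq> {}" if "i < length vs" for i
    using that
  proof (induction i)
    case 0
    show ?case using zero_in_levels_refl by fast
  next
    case (Suc i)
    have "{vs ! i, vs ! Suc i} \<in> edges P" using adj[of i "Suc i"] Suc.prems by simp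
    then have "{vs ! i, vs ! Suc i} \<in> edges G" using P(1) unfolding subgraph_def by blast
    then have "levels G w (vs ! i) (vs ! Suc i) \<noteq> {}" using weight_in_levels[OF G] by blast
    then show ?case using Suc same_component_trans by (metis Suc_lessD)
  qed
  from this[of "length vs - 1"] show ?thesis
    using ne vs by (simp add: hd_conv_nth last_conv_nth)
qed

lemma bottleneck_is_subdominant:
  assumes G: "weighted_graph G w" and conn: "connected_graph G"
  shows "is_subdominant G w (bottleneck G w)"
proof -
  have graph: "is_graph G" using G unfolding weighted_graph_def by simp
  have ne: "levels G w x y \<noteq> {}" if "x \<in> verts G" "y \<in> verts G" for x y
  proof (cases "x = y")
    case True
    then show ?thesis using zero_in_levels_refl by fast
  next
    case False
    then show ?thesis
      using conn that path_imp_levels_nonempty[OF G] unfolding connected_graph_def by blast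
  qed
  have "pseudoultrametric_on (verts G) (bottleneck G w)"
    unfolding pseudoultrametric_on_def
  proof (intro conjI ballI)
    fix x y assume x: "x \<in> verts G" and y: "y \<in> verts G"
    show "0 \<le> bottleneck G w x y" by (rule bottleneck_nonneg[OF ne[OF x y]])
    show "bottleneck G w x y = bottleneck G w y x" by (rule bottleneck_sym)
    show "bottleneck G w x x = 0" by (rule bottleneck_refl)
    fix z assume z: "z \<in> verts G"
    show "bottleneck G w x y \<le> max (bottleneck G w x z) (bottleneck G w z y)"
      by (rule bottleneck_ultra[OF ne[OF x z] ne[OF z y]])
  qed
  then have "bottleneck G w \<in> dominated_pseudoultrametrics G w"
    unfolding dominated_pseudoultrametrics_def
    by (simp add: bottleneck_le weight_in_levels[OF G])
  moreover have "\<sigma> x y \<le> bottleneck G w x y"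
    if "\<sigma> \<in> dominated_pseudoultrametrics G w" "x \<in> verts G" "y \<in> verts G" for \<sigma> x y
    unfolding bottleneck_def
  proof (rule cInf_greatest[OF ne[OF that(2,3)]])
    have \<sigma>: "pseudoultrametric_on (verts G) \<sigma>" "\<And>u v. {u, v} \<in> edges G \<Longrightarrow> \<sigma> u v \<le> w {u, v}"
      using that(1) unfolding dominated_pseudoultrametrics_def by simp_all
    fix t assume "t \<in> levels G w x y"
    then show "\<sigma> x y \<le> t"
      using bounded_along_light_walk[OF graph \<sigma> that(2)] by simp
  qed
  ultimately show ?thesis unfolding is_subdominant_def by blast
qed

lemma subdominant_extends_weight:
  assumes graph: "is_graph G" and pu: "pseudoultrametrizable G w" and sub: "is_subdominant G w \<rho>"
  shows "extends_weight G w \<rho>"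
proof -
  obtain d where d: "pseudoultrametric_on (verts G) d" "extends_weight G w d"
    using pu unfolding pseudoultrametrizable_def by blast
  then have dom: "d \<in> dominated_pseudoultrametrics G w"
    unfolding dominated_pseudoultrametrics_def extends_weight_def by simp
  have "\<rho> u v = w {u, v}" if uv: "{u, v} \<in> edges G" for u v
  proof (rule antisym)
    show "\<rho> u v \<le> w {u, v}"
      using sub uv unfolding is_subdominant_def dominated_pseudoultrametrics_def by blast
    have "d u v \<le> \<rho> u v"
      using sub dom edge_ends[OF graph uv] unfolding is_subdominant_def by blast
    then show "w {u, v} \<le> \<rho> u v"
      using d(2) uv unfolding extends_weight_def by simp
  qed
  then show ?thesis unfolding extends_weight_def by blast
qed

theorem theorem3p3:
  fixes G :: "'a sgraph" and w :: "'a set \<Rightarrow> real"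
  assumes "weighted_graph G w"
    and "edges G \<noteq> {}"
  shows "(pseudoultrametrizable G w \<longleftrightarrow>
           (\<forall>C. is_cycle C \<and> subgraph C G \<longrightarrow>
              (\<exists>e\<^sub>1 \<in> edges C. \<exists>e\<^sub>2 \<in> edges C. e\<^sub>1 \<noteq> e\<^sub>2 \<and>
                 w e\<^sub>1 = w e\<^sub>2 \<and> w e\<^sub>2 = Max (w ` edges C)))) \<and>
         (connected_graph G \<and> pseudoultrametrizable G w \<longrightarrow>
           (\<exists>\<rho>. is_subdominant G w \<rho>) \<and>
           (\<forall>\<rho>. is_subdominant G w \<rho> \<longrightarrow> extends_weight G w \<rho>))"
    (is "(_ \<longleftrightarrow> ?cycles) \<and> (_ \<longrightarrow> ?subdominant)")
proof (intro conjI iffI impI)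
  assume "pseudoultrametrizable G w"
  then show ?cycles
    unfolding pseudoultrametrizable_def using heaviest_edge_not_unique by blast
next
  assume ?cycles
  then show "pseudoultrametrizable G w"
    using pseudoultrametrizable_if_cycles[OF assms(1)] by blast
next
  assume "connected_graph G \<and> pseudoultrametrizable G w"
  then show "\<exists>\<rho>. is_subdominant G w \<rho>"
    using bottleneck_is_subdominant[OF assms(1)] by blast
next
  assume "connected_graph G \<and> pseudoultrametrizable G w"
  moreover have "is_graph G" using assms(1) unfolding weighted_graph_def by simp
  ultimately show "\<forall>\<rho>. is_subdominant G w \<rho> \<longrightarrow> extends_weight G w \<rho>"
    using subdominant_extends_weight by blast
qed

end
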